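(* Let $k\ge3$ and let $G$ be a $k$-peg Hanoi group with generating set $S$. Let $\mathcal{N}$ be its prenucleus, that is, $\mathcal{N}=\{g\in G : g|_j=g\text{ for some }j\in\mathsf{X}_k\}$. Then $G$ is contracting if and only if $\mathcal{N}$ is finite. In this case, $\mathcal{N}$ is the nucleus of $G$.
   Context: Let $\mathsf{X}$ be a finite alphabet and $\mathsf{X}^*$ the set of finite words over $\mathsf{X}$, viewed as a rooted tree; $\operatorname{Aut}\mathsf{X}^*$ is the group of permutations of $\mathsf{X}^*$ preserving word length and common prefixes. For $g\in\operatorname{Aut}\mathsf{X}^*$, the root permutation $\sigma_g\in\operatorname{Sym}(\mathsf{X})$ is the restriction of $g$ to one-letter words, and for $x\in\mathsf{X}$ the section $g|_x\in\operatorname{Aut}\mathsf{X}^*$ is defined by $g(xw)=\sigma_g(x)\,g|_x(w)$ for all $w\in\mathsf{X}^*$. For $w=x_n\ldots x_1$ set $g|_w=(g|_{x_n})|_{x_{n-1}\ldots x_1}$ inductively. A self-similar group $(G,\mathsf{X})$ is a subgroup $G\le\operatorname{Aut}\mathsf{X}^*$ with $g|_x\in G$ for all $g\in G$, $x\in\mathsf{X}$. It is contracting if there is a finite set $\mathcal{N}'\subset G$ such that for every $g\in G$ there is $n\in\mathbb{N}$ with $g|_v\in\mathcal{N}'$ for all words $v$ with $|v|\ge n$; the smallest such $\mathcal{N}'$ is called the nucleus of $G$. Let $\mathsf{X}_k=\{0,\dots,k-1\}$. A $k$-peg Hanoi automorphism is an $a\in\operatorname{Aut}\mathsf{X}_k^*$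 for which there are disjoint sets $P_a,Q_a$ with $P_a\cup Q_a=\mathsf{X}_k$, $a|_i=1$ for $i\in P_a$, $a|_j=a$ for $j\in Q_a$, and $\sigma_a$ fixing every element of $Q_a$. For $a\neq 1$ the sets are unique, and $Q_a$ is called the set of inactive pegs; for $a=1$ the set of inactive pegs is defined to be $\mathsf{X}_k$. Let $S_k$ be the set of all $k$-peg Hanoi automorphisms. A $k$-peg Hanoi group is a group $G\le\operatorname{Aut}\mathsf{X}_k^*$ together with a fixed generating set $S\subset S_k$, $1\in S$, that is state-closed (contains all sections of its elements). *)

theory Defs
  imports "HOL-Combinatorics.Permutations" "HOL-Algebra.Generated_Groups"
begin

text \<open>
  The words over an alphabet \<open>X\<close> are the elements of \<^term>\<open>lists X\<close>. A tree automorphism is a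
  total function on lists which is the identity outside \<^term>\<open>lists X\<close> (this is part of
  \<^const>\<open>permutes\<close>), so that equality of automorphisms is equality of functions. Words \<open>u\<close>, \<open>v\<close>
  with a common prefix of length \<open>n\<close> have images with a common prefix of length \<open>n\<close>; no bound on
  \<open>n\<close> is needed, since \<^prop>\<open>take n u = take n v\<close> forces \<^prop>\<open>u = v\<close> if \<open>n\<close> exceeds the length of
  one of the words.
\<close>

definition tree_automorphisms :: "'a set \<Rightarrow> ('a list \<Rightarrow> 'a list) set" where
  "tree_automorphisms X = {g. g permutes lists X \<and>
     (\<forall>u \<in> lists X. length (g u) = length u) \<and>
     (\<forall>u \<in> lists X. \<forall>v \<in> lists X. \<forall>n. take n u = take n v \<longrightarrow> take n (g u) = take n (g v))}"

definition Aut_tree :: "'a set \<Rightarrow> ('a list \<Rightarrow> 'a list) monoid" where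
  "Aut_tree X = \<lparr>carrier = tree_automorphisms X, mult = (\<circ>), one = id\<rparr>"

text \<open>
  For \<open>x \<in> X\<close> the section of a tree automorphism at \<open>x\<close> is again the identity outside
  \<^term>\<open>lists X\<close>; \<open>tree_automorphism_Cons\<close> below is the defining equation of root permutation
  and section.
\<close>

definition root_perm :: "('a list \<Rightarrow> 'a list) \<Rightarrow> 'a \<Rightarrow> 'a" where
  "root_perm g x = hd (g [x])"

definition sect :: "('a list \<Rightarrow> 'a list) \<Rightarrow> 'a \<Rightarrow> ('a list \<Rightarrow> 'a list)" where
  "sect g x = (\<lambda>w. tl (g (x # w)))"

primrec sect_word :: "('a list \<Rightarrow> 'a list) \<Rightarrow> 'a list \<Rightarrow> ('a list \<Rightarrow> 'a list)" where
  "sect_word g [] = g"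
| "sect_word g (x # w) = sect_word (sect g x) w"

lemma tree_automorphismsI:
  assumes "g permutes lists X"
    and "\<And>u. u \<in> lists X \<Longrightarrow> length (g u) = length u"
    and "\<And>u v n. u \<in> lists X \<Longrightarrow> v \<in> lists X \<Longrightarrow> take n u = take n v \<Longrightarrow> take n (g u) = take n (g v)"
  shows "g \<in> tree_automorphisms X"
  unfolding tree_automorphisms_def using assms by blast

lemma tree_automorphismsD:
  assumes "g \<in> tree_automorphisms X"
  shows "g permutes lists X"
    and "u \<in> lists X \<Longrightarrow> length (g u) = length u"
    and "u \<in> lists X \<Longrightarrow> v \<in> lists X \<Longrightarrow> take n u = take n v \<Longrightarrow> take n (g u) = take n (g v)"
  using assms unfolding tree_automorphisms_def by blast+

lemma tree_automorphism_Cons: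
  assumes g: "g \<in> tree_automorphisms X" and x: "x \<in> X" and w: "w \<in> lists X"
  shows "g (x # w) = root_perm g x # sect g x w"
proof -
  have inl: "x # w \<in> lists X" "[x] \<in> lists X" using x w by auto
  have len: "length (g (x # w)) = Suc (length w)" "length (g [x]) = 1"
    using inl[THEN tree_automorphismsD(2)[OF g]] by simp_all
  have "take 1 (g (x # w)) = take 1 (g [x])"
    by (rule tree_automorphismsD(3)[OF g inl]) simp
  then show ?thesis
    using len by (cases "g (x # w)"; cases "g [x]") (auto simp: root_perm_def sect_def)
qed

lemma group_Aut_tree: "group (Aut_tree X)"
proof (rule groupI)
  fix g assume "g \<in> carrier (Aut_tree X)"
  then have "g \<in> tree_automorphisms X" by (simp add: Aut_tree_def)
  note p = tree_automorphismsD(1)[OF this] and len = tree_automorphismsD(2)[OF this]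
    and pre = tree_automorphismsD(3)[OF this]
  let ?h = "inv_into UNIV g"
  have in_lists: "?h u \<in> lists X" if "u \<in> lists X" for u
    using permutes_in_image[OF permutes_inv[OF p]] that by blast
  have gh: "g (?h u) = u" for u using permutes_inverses[OF p] by simp
  have len': "length (?h u) = length u" if "u \<in> lists X" for u
    using len[OF in_lists[OF that]] gh by simp
  have take_eq: "g (take n u) = take n (g u)" if u: "u \<in> lists X" for u n
  proof -
    have tu: "take n u \<in> lists X" using u by (auto dest: in_set_takeD)
    have "take n (g (take n u)) = take n (g u)" by (rule pre[OF tu u]) simp
    moreover have "length (g (take n u)) \<le> n" using len[OF tu] by simp
    ultimately show ?thesis by simp
  qed
  have pre': "take n (?h u) = take n (?h v)"
    if "u \<in> lists X" "v \<in> lists X" "take n u = take n v" for u v n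
  proof -
    have "g (take n (?h u)) = take n u" "g (take n (?h v)) = take n v"
      using take_eq[OF in_lists[OF that(1)]] take_eq[OF in_lists[OF that(2)]] gh by simp_all
    then have "g (take n (?h u)) = g (take n (?h v))" using that(3) by simp
    then show ?thesis using permutes_inj[OF p] by (simp add: inj_eq)
  qed
  have "?h \<in> tree_automorphisms X"
    by (rule tree_automorphismsI[OF permutes_inv[OF p] len' pre'])
  then show "\<exists>y\<in>carrier (Aut_tree X). y \<otimes>\<^bsub>Aut_tree X\<^esub> g = \<one>\<^bsub>Aut_tree X\<^esub>"
    using permutes_inv_o[OF p] by (auto simp: Aut_tree_def)
next
  fix g h assume "g \<in> carrier (Aut_tree X)" "h \<in> carrier (Aut_tree X)"
  then have g: "g \<in> tree_automorphisms X" and h: "h \<in> tree_automorphisms X"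
    by (auto simp: Aut_tree_def)
  have inl: "h u \<in> lists X" if "u \<in> lists X" for u
    using permutes_in_image[OF tree_automorphismsD(1)[OF h], of u] that by blast
  have "g \<circ> h \<in> tree_automorphisms X"
  proof (rule tree_automorphismsI)
    show "g \<circ> h permutes lists X"
      by (rule permutes_compose[OF tree_automorphismsD(1)[OF h] tree_automorphismsD(1)[OF g]])
    show "length ((g \<circ> h) u) = length u" if "u \<in> lists X" for u
      using tree_automorphismsD(2)[OF g inl[OF that]] tree_automorphismsD(2)[OF h that] by simp
    show "take n ((g \<circ> h) u) = take n ((g \<circ> h) v)"
      if "u \<in> lists X" "v \<in> lists X" "take n u = take n v" for u v n
      unfolding comp_apply
      by (rule tree_automorphismsD(3)[OF g inl[OF that(1)] inl[OF that(2)]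
            tree_automorphismsD(3)[OF h that]])
  qed
  then show "g \<otimes>\<^bsub>Aut_tree X\<^esub> h \<in> carrier (Aut_tree X)"
    by (simp add: Aut_tree_def)
next
  show "\<one>\<^bsub>Aut_tree X\<^esub> \<in> carrier (Aut_tree X)"
    by (auto simp: Aut_tree_def permutes_id intro: tree_automorphismsI)
qed (simp_all add: Aut_tree_def o_assoc)

definition self_similar_group :: "'a set \<Rightarrow> ('a list \<Rightarrow> 'a list) set \<Rightarrow> bool" where
  "self_similar_group X G \<longleftrightarrow> finite X \<and> subgroup G (Aut_tree X) \<and> (\<forall>g \<in> G. \<forall>x \<in> X. sect g x \<in> G)"

definition contracting_set ::
    "'a set \<Rightarrow> ('a list \<Rightarrow> 'a list) set \<Rightarrow> ('a list \<Rightarrow> 'a list) set \<Rightarrow> bool" where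
  "contracting_set X G N \<longleftrightarrow> finite N \<and> N \<subseteq> G \<and>
     (\<forall>g \<in> G. \<exists>n. \<forall>v \<in> lists X. n \<le> length v \<longrightarrow> sect_word g v \<in> N)"

definition contracting :: "'a set \<Rightarrow> ('a list \<Rightarrow> 'a list) set \<Rightarrow> bool" where
  "contracting X G \<longleftrightarrow> self_similar_group X G \<and> (\<exists>N. contracting_set X G N)"

definition is_nucleus ::
    "'a set \<Rightarrow> ('a list \<Rightarrow> 'a list) set \<Rightarrow> ('a list \<Rightarrow> 'a list) set \<Rightarrow> bool" where
  "is_nucleus X G N \<longleftrightarrow> contracting_set X G N \<and> (\<forall>N'. contracting_set X G N' \<longrightarrow> N \<subseteq> N')"

definition prenucleus :: "'a set \<Rightarrow> ('a list \<Rightarrow> 'a list) set \<Rightarrow> ('a list \<Rightarrow> 'a list) set" where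
  "prenucleus X G = {g \<in> G. \<exists>j \<in> X. sect g j = g}"

definition hanoi_automorphisms :: "nat \<Rightarrow> (nat list \<Rightarrow> nat list) set" where
  "hanoi_automorphisms k = {a \<in> tree_automorphisms {..<k}.
     \<exists>P Q. P \<inter> Q = {} \<and> P \<union> Q = {..<k} \<and>
       (\<forall>i \<in> P. sect a i = id) \<and> (\<forall>j \<in> Q. sect a j = a) \<and> (\<forall>j \<in> Q. root_perm a j = j)}"

definition hanoi_group :: "nat \<Rightarrow> (nat list \<Rightarrow> nat list) set \<Rightarrow> (nat list \<Rightarrow> nat list) set \<Rightarrow> bool" where
  "hanoi_group k G S \<longleftrightarrow> subgroup G (Aut_tree {..<k}) \<and>
     S \<subseteq> hanoi_automorphisms k \<and> id \<in> S \<and> generate (Aut_tree {..<k}) S = G \<and>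
     (\<forall>s \<in> S. \<forall>x \<in> {..<k}. sect s x \<in> S)"

end

theory Submission
  imports Defs
begin

text \<open>
  Every element \<open>g\<close> of a Hanoi group is a product of Hanoi automorphisms in the group: inverses of
  Hanoi automorphisms are Hanoi automorphisms, so a word of positive letters suffices. The section
  at a peg \<open>x\<close> of such a product is computed letter by letter, following the image of \<open>x\<close> under
  the letters already applied, and each letter is either erased or kept. If no letter is erased,
  then every letter is kept, \<open>x\<close> is never moved, and so \<open>x\<close> is a common inactive peg of all
  letters and \<open>g|\<^sub>x = g\<close>; otherwise the word becomes shorter
  (\<open>sect_prod_word_hanoi\<close>). Two consequences give the theorem.

  Firstly, the prenucleus is closed under sections (\<open>sect_prenucleus\<close>). Write \<open>g\<close> with
  \<open>g|\<^sub>j = g\<close> as a word of minimal length. Taking the section at \<open>j\<close> cannot shorten it, so \<open>j\<close> is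
  inactive for all its letters. The section of \<open>g\<close> at any other peg is a product of some of these
  letters, hence is again fixed by taking the section at \<open>j\<close>.

  Secondly, the sections at all pegs of an element outside the prenucleus have shorter words. Hence a
  product of \<open>n\<close> letters has all its sections at words of length at least \<open>n\<close> in the prenucleus
  (\<open>sect_word_in_prenucleus\<close>).

  So the prenucleus absorbs every element of the group, and it is a contracting set as soon as it
  is finite. Conversely, \<open>g|\<^sub>j = g\<close> gives \<open>g|\<^sub>v = g\<close> for the arbitrarily long words \<open>v = jj\<dots>j\<close>,
  so every contracting set contains the prenucleus.
\<close>

section \<open>Sections of products of tree automorphisms\<close>

lemma id_in_tree_automorphisms: "id \<in> tree_automorphisms X"
  by (auto simp: permutes_id intro: tree_automorphismsI)

lemma comp_in_tree_automorphisms: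
  assumes "g \<in> tree_automorphisms X" "h \<in> tree_automorphisms X"
  shows "g \<circ> h \<in> tree_automorphisms X"
  using monoid.m_closed[OF group.is_monoid[OF group_Aut_tree], of g X h] assms
  by (simp add: Aut_tree_def)

lemma in_lists_iff:
  "g \<in> tree_automorphisms X \<Longrightarrow> g u \<in> lists X \<longleftrightarrow> u \<in> lists X"
  by (rule permutes_in_image[OF tree_automorphismsD(1)])

lemma root_perm_in:
  assumes "g \<in> tree_automorphisms X" "x \<in> X"
  shows "root_perm g x \<in> X"
  using tree_automorphism_Cons[OF assms, of "[]"] in_lists_iff[OF assms(1), of "[x]"] assms(2)
  by simp

lemma root_perm_id [simp]: "root_perm id x = x"
  by (simp add: root_perm_def)

lemma sect_id [simp]: "sect id x = id"
  by (simp add: sect_def fun_eq_iff)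

lemma comp_Cons:
  assumes g: "g \<in> tree_automorphisms X" and h: "h \<in> tree_automorphisms X"
    and x: "x \<in> X" and w: "w \<in> lists X"
  shows "(g \<circ> h) (x # w) = root_perm g (root_perm h x) # sect g (root_perm h x) (sect h x w)"
proof -
  have "root_perm h x # sect h x w \<in> lists X"
    using in_lists_iff[OF h, of "x # w"] tree_automorphism_Cons[OF h x w] x w by simp
  then show ?thesis
    using tree_automorphism_Cons[OF h x w] tree_automorphism_Cons[OF g] by simp
qed

lemma root_perm_comp:
  assumes "g \<in> tree_automorphisms X" "h \<in> tree_automorphisms X" "x \<in> X"
  shows "root_perm (g \<circ> h) x = root_perm g (root_perm h x)"
  using comp_Cons[OF assms, of "[]"] by (simp add: root_perm_def)

lemma sect_comp:
  assumes g: "g \<in> tree_automorphisms X" and h: "h \<in> tree_automorphisms X" and x: "x \<in> X"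
  shows "sect (g \<circ> h) x = sect g (root_perm h x) \<circ> sect h x"
proof
  fix w
  show "sect (g \<circ> h) x w = (sect g (root_perm h x) \<circ> sect h x) w"
  proof (cases "w \<in> lists X")
    case True
    then show ?thesis using comp_Cons[OF assms True] by (simp add: sect_def)
  next
    case False
    then have "g (y # w) = y # w" "h (y # w) = y # w" for y
      using permutes_not_in[OF tree_automorphismsD(1)[OF g], of "y # w"]
        permutes_not_in[OF tree_automorphismsD(1)[OF h], of "y # w"] by auto
    then show ?thesis by (simp add: sect_def)
  qed
qed

section \<open>Hanoi automorphisms\<close>

definition inactive :: "('a list \<Rightarrow> 'a list) \<Rightarrow> 'a \<Rightarrow> bool" where
  "inactive a x \<longleftrightarrow> sect a x = a \<and> root_perm a x = x"

text \<open>
  Deciding activity peg by peg does away with the choice of a partition, which is not unique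
  for the identity.
\<close>

lemma hanoi_automorphisms_iff:
  "a \<in> hanoi_automorphisms k \<longleftrightarrow>
     a \<in> tree_automorphisms {..<k} \<and> (\<forall>x\<in>{..<k}. sect a x = id \<or> inactive a x)"
    (is "_ \<longleftrightarrow> ?R")
proof
  assume "a \<in> hanoi_automorphisms k"
  then show ?R unfolding hanoi_automorphisms_def inactive_def by blast
next
  assume R: ?R
  let ?Q = "{x \<in> {..<k}. inactive a x}"
  have "({..<k} - ?Q) \<inter> ?Q = {} \<and> ({..<k} - ?Q) \<union> ?Q = {..<k} \<and>
      (\<forall>i \<in> {..<k} - ?Q. sect a i = id) \<and> (\<forall>j \<in> ?Q. sect a j = a) \<and> (\<forall>j \<in> ?Q. root_perm a j = j)"
    using R unfolding inactive_def by blast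
  with R show "a \<in> hanoi_automorphisms k" unfolding hanoi_automorphisms_def by blast
qed

lemma hanoi_automorphismsD:
  assumes "a \<in> hanoi_automorphisms k"
  shows "a \<in> tree_automorphisms {..<k}"
    and "x < k \<Longrightarrow> sect a x = id \<or> inactive a x"
  using assms by (auto simp: hanoi_automorphisms_iff)

text \<open>
  An inactive peg of \<open>a\<close> is fixed by \<open>a\<close>, hence is inactive for the inverse as well. So the root
  permutation of the inverse maps each remaining peg to a peg at which \<open>a\<close> has trivial section.
\<close>

lemma inverse_in_hanoi_automorphisms:
  assumes a: "a \<in> hanoi_automorphisms k" and b: "b \<in> tree_automorphisms {..<k}"
    and ab: "a \<circ> b = id" and ba: "b \<circ> a = id"
  shows "b \<in> hanoi_automorphisms k"
  unfolding hanoi_automorphisms_iff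
proof (intro conjI ballI b)
  fix x assume x: "x \<in> {..<k}"
  note aT = hanoi_automorphismsD(1)[OF a]
  have inactive_inverse: "inactive b y" if "y \<in> {..<k}" "inactive a y" for y
  proof -
    have root: "root_perm b y = y"
      using root_perm_comp[OF b aT that(1)] that(2) ba by (simp add: inactive_def)
    have "sect b y \<circ> a = id"
      using sect_comp[OF b aT that(1)] that(2) ba by (simp add: inactive_def)
    then have "(sect b y \<circ> a) \<circ> b = b" by simp
    then have "sect b y = b" by (simp add: o_assoc[symmetric] ab)
    with root show ?thesis by (simp add: inactive_def)
  qed
  let ?y = "root_perm b x"
  have y: "?y \<in> {..<k}" by (rule root_perm_in[OF b x])
  have ay: "root_perm a ?y = x" using root_perm_comp[OF aT b x] ab by simp
  show "sect b x = id \<or> inactive b x"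
  proof (cases "inactive a ?y")
    case True
    then have "?y = x" using ay by (simp add: inactive_def)
    then show ?thesis using inactive_inverse[OF x] True by simp
  next
    case False
    then have "sect a ?y = id" using hanoi_automorphismsD(2)[OF a] y by auto
    then show ?thesis using sect_comp[OF aT b x] ab by simp
  qed
qed

section \<open>Words of Hanoi automorphisms\<close>

primrec prod_word :: "('a \<Rightarrow> 'a) list \<Rightarrow> 'a \<Rightarrow> 'a" where
  "prod_word [] = id"
| "prod_word (a # ws) = a \<circ> prod_word ws"

lemma prod_word_append: "prod_word (us @ vs) = prod_word us \<circ> prod_word vs"
  by (induction us) (auto simp: o_assoc)

lemma prod_word_in_tree_automorphisms:
  "set ws \<subseteq> tree_automorphisms X \<Longrightarrow> prod_word ws \<in> tree_automorphisms X"
  by (induction ws) (auto intro: id_in_tree_automorphisms comp_in_tree_automorphisms)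

lemma inactive_prod_word:
  assumes "set ws \<subseteq> tree_automorphisms X" "x \<in> X" "\<forall>a\<in>set ws. inactive a x"
  shows "inactive (prod_word ws) x"
  using assms
proof (induction ws)
  case (Cons a ws)
  then have "prod_word ws \<in> tree_automorphisms X" "inactive (prod_word ws) x"
    using prod_word_in_tree_automorphisms by auto
  then show ?case
    using Cons.prems sect_comp[of a X "prod_word ws" x] root_perm_comp[of a X "prod_word ws" x]
    by (simp add: inactive_def del: comp_apply)
qed (simp add: inactive_def del: id_apply)

text \<open>
  Letters act from right to left, so the word is read from its end. As long as no letter has been
  erased, the peg has not moved, and the next letter meets \<open>x\<close> itself; after the first erased
  letter only the length matters.
\<close>

lemma sect_prod_word_hanoi:
  assumes "set ws \<subseteq> hanoi_automorphisms k" "x < k"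
  obtains us where "set us \<subseteq> set ws" "sect (prod_word ws) x = prod_word us"
    "(\<forall>a\<in>set ws. inactive a x) \<or> length us < length ws"
proof -
  have "\<exists>us. set us \<subseteq> set ws \<and> sect (prod_word ws) x = prod_word us \<and>
      ((\<forall>a\<in>set ws. inactive a x) \<and> us = ws \<or> length us < length ws)"
    using assms
  proof (induction ws)
    case Nil
    then show ?case by (simp del: id_apply)
  next
    case (Cons a ws)
    then obtain us where us: "set us \<subseteq> set ws" "sect (prod_word ws) x = prod_word us"
      "(\<forall>a\<in>set ws. inactive a x) \<and> us = ws \<or> length us < length ws" by auto
    let ?g = "prod_word ws" and ?y = "root_perm (prod_word ws) x"
    have a: "a \<in> hanoi_automorphisms k" and x: "x \<in> {..<k}"
      and wsT: "set ws \<subseteq> tree_automorphisms {..<k}"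
      using Cons.prems hanoi_automorphismsD(1) by auto
    note g = prod_word_in_tree_automorphisms[OF wsT]
    have y: "?y < k" using root_perm_in[OF g x] by simp
    have eq: "sect (prod_word (a # ws)) x = sect a ?y \<circ> prod_word us"
      using sect_comp[OF hanoi_automorphismsD(1)[OF a] g x] us(2) by simp
    show ?case
    proof (cases "inactive a ?y")
      case True
      have "?y = x" if "\<forall>a\<in>set ws. inactive a x"
        using inactive_prod_word[OF wsT x that] by (simp add: inactive_def)
      with True have "(\<forall>b\<in>set (a # ws). inactive b x) \<and> a # us = a # ws \<or>
          length (a # us) < length (a # ws)"
        using us(3) by auto
      moreover have "sect (prod_word (a # ws)) x = prod_word (a # us)"
        using eq True by (simp add: inactive_def)
      ultimately show ?thesis using us(1) by (intro exI[of _ "a # us"]) (auto simp del: comp_apply)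
    next
      case False
      then have "sect a ?y = id" using hanoi_automorphismsD(2)[OF a y] by blast
      then show ?thesis using eq us(1,3) by (intro exI[of _ us]) (auto simp del: comp_apply)
    qed
  qed
  then show thesis using that by blast
qed

section \<open>The prenucleus of a Hanoi group\<close>

lemma hanoi_groupD:
  assumes "hanoi_group k G S"
  shows "id \<in> G" "G \<subseteq> tree_automorphisms {..<k}"
    and "g \<in> G \<Longrightarrow> h \<in> G \<Longrightarrow> g \<circ> h \<in> G"
proof -
  have "subgroup G (Aut_tree {..<k})" using assms by (simp add: hanoi_group_def)
  from subgroup.one_closed[OF this] subgroup.subset[OF this] subgroup.m_closed[OF this]
  show "id \<in> G" "G \<subseteq> tree_automorphisms {..<k}" "g \<in> G \<Longrightarrow> h \<in> G \<Longrightarrow> g \<circ> h \<in> G"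
    by (auto simp: Aut_tree_def)
qed

lemma prod_word_in_hanoi_group:
  assumes "hanoi_group k G S" "set ws \<subseteq> G"
  shows "prod_word ws \<in> G"
  using assms(2) by (induction ws) (auto intro: hanoi_groupD[OF assms(1)])

text \<open>
  The letters range over all Hanoi automorphisms in \<open>G\<close>, not only over \<open>S\<close>, since \<open>S\<close> need not be
  closed under inverses.
\<close>

lemma hanoi_group_word:
  assumes G: "hanoi_group k G S" and g: "g \<in> G"
  obtains ws where "set ws \<subseteq> hanoi_automorphisms k \<inter> G" "g = prod_word ws"
proof -
  let ?A = "Aut_tree {..<k}"
  interpret A: group ?A by (rule group_Aut_tree)
  have sub: "subgroup G ?A" and S: "S \<subseteq> hanoi_automorphisms k" and gen: "generate ?A S = G"
    using G by (auto simp: hanoi_group_def)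
  have SG: "S \<subseteq> G" using gen generate.incl by fast
  have "g \<in> generate ?A S" using g gen by simp
  then have "\<exists>ws. set ws \<subseteq> hanoi_automorphisms k \<inter> G \<and> g = prod_word ws"
  proof induction
    case one
    show ?case by (intro exI[of _ "[]"]) (simp add: Aut_tree_def)
  next
    case (incl h)
    then show ?case using S SG by (intro exI[of _ "[h]"]) auto
  next
    case (inv h)
    then have h: "h \<in> hanoi_automorphisms k" "h \<in> G" using S SG by auto
    then have hA: "h \<in> carrier ?A" using subgroup.subset[OF sub] by blast
    have "inv\<^bsub>?A\<^esub> h \<in> hanoi_automorphisms k"
      using A.inv_closed[OF hA] A.r_inv[OF hA] A.l_inv[OF hA]
      by (intro inverse_in_hanoi_automorphisms[OF h(1)]) (simp_all add: Aut_tree_def)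
    moreover have "inv\<^bsub>?A\<^esub> h \<in> G" by (rule subgroup.m_inv_closed[OF sub h(2)])
    ultimately show ?case by (intro exI[of _ "[inv\<^bsub>?A\<^esub> h]"]) auto
  next
    case (eng h1 h2)
    then obtain us vs where
      "set us \<subseteq> hanoi_automorphisms k \<inter> G" "h1 = prod_word us"
      "set vs \<subseteq> hanoi_automorphisms k \<inter> G" "h2 = prod_word vs" by blast
    then show ?case
      by (intro exI[of _ "us @ vs"]) (auto simp: prod_word_append Aut_tree_def)
  qed
  then show thesis using that by blast
qed

lemma sect_in_hanoi_group:
  assumes G: "hanoi_group k G S" and g: "g \<in> G" and x: "x < k"
  shows "sect g x \<in> G"
proof -
  obtain ws where ws: "set ws \<subseteq> hanoi_automorphisms k \<inter> G" "g = prod_word ws"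
    by (rule hanoi_group_word[OF G g])
  then obtain us where "set us \<subseteq> set ws" "sect g x = prod_word us"
    using sect_prod_word_hanoi[OF _ x, of ws] by (metis le_inf_iff)
  then show ?thesis using prod_word_in_hanoi_group[OF G, of us] ws(1) by auto
qed

lemma self_similar_hanoi_group:
  assumes "hanoi_group k G S"
  shows "self_similar_group {..<k} G"
  using assms sect_in_hanoi_group[OF assms] by (auto simp: self_similar_group_def hanoi_group_def)

text \<open>
  Minimality of the word turns the equation \<open>g|\<^sub>j = g\<close>, which speaks only of the product, into
  a property of the letters that subwords inherit.
\<close>

lemma sect_prenucleus:
  assumes G: "hanoi_group k G S" and g: "g \<in> prenucleus {..<k} G" and x: "x < k"
  shows "sect g x \<in> prenucleus {..<k} G"
proof -
  obtain j where gG: "g \<in> G" and j: "j < k" "sect g j = g"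
    using g by (auto simp: prenucleus_def)
  let ?W = "\<lambda>ws. set ws \<subseteq> hanoi_automorphisms k \<inter> G \<and> g = prod_word ws"
  have "\<exists>ws. ?W ws" using hanoi_group_word[OF G gG] by blast
  then obtain ws where ws: "?W ws" and minimal: "\<And>us. ?W us \<Longrightarrow> length ws \<le> length us"
    using ex_has_least_nat[of ?W _ length] by blast
  have wsH: "set ws \<subseteq> hanoi_automorphisms k" using ws by blast
  have inact: "\<forall>a\<in>set ws. inactive a j"
  proof -
    obtain us where us: "set us \<subseteq> set ws" "sect (prod_word ws) j = prod_word us"
      "(\<forall>a\<in>set ws. inactive a j) \<or> length us < length ws"
      by (rule sect_prod_word_hanoi[OF wsH j(1)])
    then have "?W us" using ws j(2) by auto
    from minimal[OF this] us(3) show ?thesis by auto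
  qed
  obtain us where us: "set us \<subseteq> set ws" "sect (prod_word ws) x = prod_word us"
    by (rule sect_prod_word_hanoi[OF wsH x])
  have "set us \<subseteq> tree_automorphisms {..<k}"
    using us(1) wsH hanoi_automorphismsD(1) by blast
  then have "inactive (prod_word us) j"
    using inactive_prod_word[of us "{..<k}" j] j(1) inact us(1) by blast
  then have "sect (sect g x) j = sect g x" using ws us(2) by (simp add: inactive_def)
  then show ?thesis
    using sect_in_hanoi_group[OF G gG x] j(1) by (auto simp: prenucleus_def)
qed

lemma sect_word_prenucleus:
  assumes "hanoi_group k G S"
  shows "g \<in> prenucleus {..<k} G \<Longrightarrow> v \<in> lists {..<k} \<Longrightarrow> sect_word g v \<in> prenucleus {..<k} G"
  by (induction v arbitrary: g) (auto intro: sect_prenucleus[OF assms])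

text \<open>
  Each further peg of \<open>v\<close> either shortens the word or shows that the current section lies in the
  prenucleus, which is then never left.
\<close>

lemma sect_word_in_prenucleus:
  assumes G: "hanoi_group k G S" and k: "0 < k"
  shows "set ws \<subseteq> hanoi_automorphisms k \<inter> G \<Longrightarrow> v \<in> lists {..<k} \<Longrightarrow> length ws \<le> length v \<Longrightarrow>
    sect_word (prod_word ws) v \<in> prenucleus {..<k} G"
proof (induction v arbitrary: ws)
  case Nil
  then show ?case using hanoi_groupD(1)[OF G] k by (auto simp: prenucleus_def simp del: id_apply)
next
  case (Cons x v)
  have wsH: "set ws \<subseteq> hanoi_automorphisms k" and wsG: "set ws \<subseteq> G" and x: "x < k"
    using Cons.prems by auto
  obtain us where us: "set us \<subseteq> set ws" "sect (prod_word ws) x = prod_word us"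
    "(\<forall>a\<in>set ws. inactive a x) \<or> length us < length ws"
    by (rule sect_prod_word_hanoi[OF wsH x])
  from us(3) show ?case
  proof
    assume "\<forall>a\<in>set ws. inactive a x"
    moreover have "set ws \<subseteq> tree_automorphisms {..<k}"
      using wsH hanoi_automorphismsD(1) by blast
    ultimately have "sect (prod_word ws) x = prod_word ws"
      using inactive_prod_word[of ws "{..<k}" x] x by (simp add: inactive_def)
    then have "prod_word ws \<in> prenucleus {..<k} G"
      using prod_word_in_hanoi_group[OF G wsG] x by (auto simp: prenucleus_def)
    then show ?thesis using sect_word_prenucleus[OF G _ Cons.prems(2)] by blast
  next
    assume "length us < length ws"
    then show ?thesis using Cons.IH[of us] Cons.prems us(1,2) by auto
  qed
qed

section \<open>The prenucleus and contraction\<close>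

lemma contracting_set_prenucleus:
  assumes G: "hanoi_group k G S" and k: "0 < k" and fin: "finite (prenucleus {..<k} G)"
  shows "contracting_set {..<k} G (prenucleus {..<k} G)"
  unfolding contracting_set_def
proof (intro conjI ballI fin)
  show "prenucleus {..<k} G \<subseteq> G" by (auto simp: prenucleus_def)
  fix g assume "g \<in> G"
  then obtain ws where "set ws \<subseteq> hanoi_automorphisms k \<inter> G" "g = prod_word ws"
    by (rule hanoi_group_word[OF G])
  then show "\<exists>n. \<forall>v\<in>lists {..<k}. n \<le> length v \<longrightarrow> sect_word g v \<in> prenucleus {..<k} G"
    using sect_word_in_prenucleus[OF G k] by blast
qed

lemma sect_word_replicate: "sect g j = g \<Longrightarrow> sect_word g (replicate n j) = g"
  by (induction n) auto

lemma prenucleus_subset_contracting_set: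
  assumes "contracting_set X G N"
  shows "prenucleus X G \<subseteq> N"
proof
  fix g assume "g \<in> prenucleus X G"
  then obtain j where g: "g \<in> G" and j: "j \<in> X" "sect g j = g" by (auto simp: prenucleus_def)
  obtain n where "\<forall>v\<in>lists X. n \<le> length v \<longrightarrow> sect_word g v \<in> N"
    using assms g unfolding contracting_set_def by blast
  moreover have "replicate n j \<in> lists X" using j(1) by auto
  ultimately have "sect_word g (replicate n j) \<in> N" by simp
  then show "g \<in> N" using sect_word_replicate[OF j(2)] by simp
qed

theorem theorem4p1:
  fixes k :: nat and G S :: "(nat list \<Rightarrow> nat list) set"
  assumes "3 \<le> k" and "hanoi_group k G S"
  shows "(contracting {..<k} G \<longleftrightarrow> finite (prenucleus {..<k} G)) \<and>
         (contracting {..<k} G \<longrightarrow> is_nucleus {..<k} G (prenucleus {..<k} G))"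
proof -
  let ?N = "prenucleus {..<k} G"
  have "finite ?N" if "contracting {..<k} G"
  proof -
    from that obtain N where N: "contracting_set {..<k} G N" by (auto simp: contracting_def)
    then have "finite N" by (simp add: contracting_set_def)
    then show ?thesis
      using prenucleus_subset_contracting_set[OF N] by (rule rev_finite_subset)
  qed
  moreover have "contracting_set {..<k} G ?N" if "finite ?N"
    using contracting_set_prenucleus[OF assms(2) _ that] assms(1) by simp
  ultimately show ?thesis
    using self_similar_hanoi_group[OF assms(2)] prenucleus_subset_contracting_set
    unfolding contracting_def is_nucleus_def by blast
qed

end
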